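(* Let $A:\mathbb{R}^n\rightrightarrows\mathbb{R}^n$ be a set-valued operator, $\mathcal{M}\subset\mathbb{R}^n$ a $C^p$-manifold ($p\ge 1$), and $\bar x\in\mathcal{M}$. Suppose that (A.1) $A$ is partly smooth at $\bar x$ relative to $\mathcal{M}$; (A.2) $A$ is $r$-resolvent-regular at $\bar x$ for $\bar u\in A(\bar x)$; (A.3) $\bar u\in\operatorname{ri}(A(\bar x))$. Let $\gamma\in\,]0,1/r[$, let $\varepsilon>0$ be sufficiently small, and let $$\mathcal{U}_{\varepsilon,\gamma}=\bigcup_{x\in\mathcal{M}\cap B_\varepsilon(\bar x)}\bigl(x+\gamma A_\varepsilon(x)\bigr),$$ where $A_\varepsilon$ is the $\varepsilon$-localization of $A$ around $(\bar x,\bar u)$. For $\delta>0$ small enough, let $\mathcal{U}_{\varepsilon,\gamma}\ominus\mathcal{B}_\delta$ be the erosion of $\mathcal{U}_{\varepsilon,\gamma}$ by the ball $\mathcal{B}_\delta$ of radius $\delta$ centred at the origin. Then: (i) With $\bar z=\bar x+\gamma\bar u$, one has $\bar z\in\operatorname{int}(\mathcal{U}_{\varepsilon,\gamma})$. (ii) For any sequence $(x^{(k)},u^{(k)})_{k\in\mathbb{N}}$ with $u^{(k)}\in A_\varepsilon(x^{(k)})$: if $x^{(k)}+\gamma u^{(k)}\in\mathcal{U}_{\varepsilon,\gamma}\ominus\mathcal{B}_\delta$, then $x^{(k)}\in\mathcal{M}$.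
   Context: Notation. $B_\varepsilon(\bar x)=\{x:\|x-\bar x\|<\varepsilon\}$. $\operatorname{ri}$ denotes relative interior. For a convex set $S$, $\operatorname{Lin}(S)=\operatorname{Aff}(S)-x$ ($x\in S$) is the linear subspace parallel to the affine hull of $S$. $T_{\mathcal{M}}(x)$, $N_{\mathcal{M}}(x)$ are the tangent and normal spaces of the manifold $\mathcal{M}$ at $x\in\mathcal{M}$; $P_V$ is the orthogonal projection onto $V$. The erosion is $\mathcal{U}\ominus\mathcal{B}_\delta=\{z: z+\mathcal{B}_\delta\subset\mathcal{U}\}$. Semicontinuity. $A$ is lower semi-continuous at $\bar x$ if for every $\bar u\in A(\bar x)$ and every sequence $x^{(k)}\in\operatorname{dom}A$ with $x^{(k)}\to\bar x$ there are $u^{(k)}\in A(x^{(k)})$ with $u^{(k)}\to\bar u$. $A$ is upper semi-continuous at $\bar x$ if $x^{(k)}\to\bar x$, $u^{(k)}\in A(x^{(k)})$, $u^{(k)}\to\bar u$ imply $\bar u\in A(\bar x)$. $A$ is upper semi-continuous if it is so at every point of its domain. Continuous along $\mathcal{M}$ means both lower and upper semi-continuous with sequences restricted to $\mathcal{M}$. Partly smooth operator. $A$ is partly smooth at $\bar x$ relative to a set $\mathcal{M}\ni\bar x$ if $\mathcal{M}$ is a $C^p$-manifold around $\bar x$, $A$ is upper semi-continuous, and: (Regularity) for every $x$ close to $\bar x$, $A(x)$ is nonempty, closed and convex; (Sharpness) $N_{\mathcal{M}}(\bar x)=\operatorname{Lin}(A(\bar x))$, and $x\mapsto P_{T_{\mathcal{M}}(x)}(A(x))$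 is single-valued and continuous around $\bar x$ along $\mathcal{M}$; (Continuity) $A$ is continuous along $\mathcal{M}$ near $\bar x$. Localization. For $\varepsilon>0$ the $\varepsilon$-localization of $A$ around $(\bar x,\bar u)\in\operatorname{gra}(A)$ is $A_\varepsilon(x)=\{u\in A(x):\|u-\bar u\|<\varepsilon\}$ if $\|x-\bar x\|<\varepsilon$, and $A_\varepsilon(x)=\emptyset$ otherwise. Resolvent-regularity. $A$ is ($r$-)resolvent-regular at $\bar x$ for $\bar u\in A(\bar x)$ if there are $\varepsilon>0$ and $r>0$ such that $r\,\mathrm{Id}+A_\varepsilon$ is monotone and, for each $\gamma\in\,]0,1/r[$, there is a neighbourhood of $\bar x+\gamma\bar u$ on which the resolvent $J_{\gamma A_\varepsilon}=(\mathrm{Id}+\gamma A_\varepsilon)^{-1}$ is single-valued and continuous. *)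

theory Defs
  imports "HOL-Analysis.Analysis"
begin

section \<open>Submanifolds of Euclidean space\<close>

text \<open>
  \<open>Ck_on k f S\<close> is meant for open \<open>S\<close>. In finite dimension the derivative is a \<open>C\<^sup>k\<close> map into the
  space of linear maps iff each of the maps \<open>x \<mapsto> Df(x) v\<close> is \<open>C\<^sup>k\<close>.
\<close>

primrec Ck_on :: "nat \<Rightarrow> ('a::euclidean_space \<Rightarrow> 'b::euclidean_space) \<Rightarrow> 'a set \<Rightarrow> bool" where
  "Ck_on 0 f S \<longleftrightarrow> continuous_on S f"
| "Ck_on (Suc k) f S \<longleftrightarrow>
     (\<forall>x\<in>S. f differentiable (at x)) \<and> (\<forall>v. Ck_on k (\<lambda>x. frechet_derivative f (at x) v) S)"

text \<open>
  Embedded submanifold near \<open>x\<close>: some \<open>C\<^sup>p\<close> diffeomorphism \<open>\<phi>\<close> from a neighbourhood of \<open>x\<close> onto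
  an open set flattens \<open>M\<close> to a linear subspace.
\<close>

definition manifold_around :: "nat \<Rightarrow> 'a::euclidean_space set \<Rightarrow> 'a \<Rightarrow> bool" where
  "manifold_around p M x \<longleftrightarrow>
     (\<exists>(U::'a set) (V::'a set) (W::'a set) \<phi> \<psi>.
        open U \<and> x \<in> U \<and> open V \<and> subspace W \<and>
        homeomorphism U V \<phi> \<psi> \<and> Ck_on p \<phi> U \<and> Ck_on p \<psi> V \<and>
        \<phi> ` (M \<inter> U) = W \<inter> V)"

definition manifold :: "nat \<Rightarrow> 'a::euclidean_space set \<Rightarrow> bool" where
  "manifold p M \<longleftrightarrow> (\<forall>x\<in>M. manifold_around p M x)"

definition tangent_space :: "'a::euclidean_space set \<Rightarrow> 'a \<Rightarrow> 'a set" where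
  "tangent_space M x =
     {v. \<exists>c e. 0 < e \<and> c C1_differentiable_on {-e<..<e} \<and> c ` {-e<..<e} \<subseteq> M \<and>
               c 0 = x \<and> (c has_vector_derivative v) (at 0)}"

definition normal_space :: "'a::euclidean_space set \<Rightarrow> 'a \<Rightarrow> 'a set" where
  "normal_space M x = (tangent_space M x)\<^sup>\<bottom>"

text \<open>
  For nonempty \<open>S\<close> all the translates \<open>Aff(S) - x\<close> with \<open>x \<in> S\<close> are the same linear subspace,
  hence equal to their union.
\<close>

definition Lin :: "'a::euclidean_space set \<Rightarrow> 'a set" where
  "Lin S = {y - x | x y. x \<in> S \<and> y \<in> affine hull S}"

section \<open>Set-valued operators\<close>

definition dom_op :: "('a \<Rightarrow> 'b set) \<Rightarrow> 'a set" where
  "dom_op A = {x. A x \<noteq> {}}"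

definition lsc_along ::
  "'a set \<Rightarrow> ('a::topological_space \<Rightarrow> 'b::topological_space set) \<Rightarrow> 'a \<Rightarrow> bool" where
  "lsc_along M A x \<longleftrightarrow>
     (\<forall>u\<in>A x. \<forall>X. (\<forall>k::nat. X k \<in> M \<inter> dom_op A) \<and> X \<longlonglongrightarrow> x \<longrightarrow>
        (\<exists>U. (\<forall>k. U k \<in> A (X k)) \<and> U \<longlonglongrightarrow> u))"

definition usc_along ::
  "'a set \<Rightarrow> ('a::topological_space \<Rightarrow> 'b::topological_space set) \<Rightarrow> 'a \<Rightarrow> bool" where
  "usc_along M A x \<longleftrightarrow>
     (\<forall>X U u. (\<forall>k::nat. X k \<in> M \<and> U k \<in> A (X k)) \<and> X \<longlonglongrightarrow> x \<and> U \<longlonglongrightarrow> u \<longrightarrow> u \<in> A x)"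

definition usc :: "('a::topological_space \<Rightarrow> 'b::topological_space set) \<Rightarrow> bool" where
  "usc A \<longleftrightarrow> (\<forall>x\<in>dom_op A. usc_along UNIV A x)"

definition continuous_along ::
  "'a set \<Rightarrow> ('a::topological_space \<Rightarrow> 'b::topological_space set) \<Rightarrow> 'a \<Rightarrow> bool" where
  "continuous_along M A x \<longleftrightarrow> lsc_along M A x \<and> usc_along M A x"

definition single_valued_continuous_on ::
  "'a set \<Rightarrow> ('a::topological_space \<Rightarrow> 'b::topological_space set) \<Rightarrow> bool" where
  "single_valued_continuous_on S A \<longleftrightarrow> (\<exists>f. continuous_on S f \<and> (\<forall>x\<in>S. A x = {f x}))"

text \<open>
  On the linear subspace \<^term>\<open>tangent_space M x\<close>, \<^const>\<open>closest_point\<close> is the orthogonal projection.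
\<close>

definition partly_smooth ::
  "nat \<Rightarrow> 'a set \<Rightarrow> ('a::euclidean_space \<Rightarrow> 'a set) \<Rightarrow> 'a \<Rightarrow> bool" where
  "partly_smooth p M A x \<longleftrightarrow>
     x \<in> M \<and> manifold_around p M x \<and> usc A \<and>
     (\<forall>\<^sub>F y in nhds x. A y \<noteq> {} \<and> closed (A y) \<and> convex (A y)) \<and>
     normal_space M x = Lin (A x) \<and>
     (\<exists>e>0. single_valued_continuous_on (M \<inter> ball x e)
              (\<lambda>y. closest_point (tangent_space M y) ` A y)) \<and>
     (\<exists>e>0. \<forall>y\<in>M \<inter> ball x e. continuous_along M A y)"

definition localization ::
  "('a::real_normed_vector \<Rightarrow> 'a set) \<Rightarrow> 'a \<Rightarrow> 'a \<Rightarrow> real \<Rightarrow> 'a \<Rightarrow> 'a set" where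
  "localization A xb ub e x = (if norm (x - xb) < e then {u \<in> A x. norm (u - ub) < e} else {})"

definition monotone_op :: "('a::real_inner \<Rightarrow> 'a set) \<Rightarrow> bool" where
  "monotone_op B \<longleftrightarrow> (\<forall>x y. \<forall>u\<in>B x. \<forall>v\<in>B y. 0 \<le> (u - v) \<bullet> (x - y))"

definition inverse_op :: "('a \<Rightarrow> 'b set) \<Rightarrow> 'b \<Rightarrow> 'a set" where
  "inverse_op B z = {x. z \<in> B x}"

definition resolvent :: "real \<Rightarrow> ('a::real_vector \<Rightarrow> 'a set) \<Rightarrow> 'a \<Rightarrow> 'a set" where
  "resolvent \<gamma> B = inverse_op (\<lambda>x. {x + \<gamma> *\<^sub>R u | u. u \<in> B x})"

definition resolvent_regular ::
  "real \<Rightarrow> ('a::euclidean_space \<Rightarrow> 'a set) \<Rightarrow> 'a \<Rightarrow> 'a \<Rightarrow> bool" where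
  "resolvent_regular r A xb ub \<longleftrightarrow>
     0 < r \<and> ub \<in> A xb \<and>
     (\<exists>e>0. monotone_op (\<lambda>x. {r *\<^sub>R x + u | u. u \<in> localization A xb ub e x}) \<and>
        (\<forall>\<gamma>\<in>{0<..<1/r}. \<exists>Z. open Z \<and> xb + \<gamma> *\<^sub>R ub \<in> Z \<and>
           single_valued_continuous_on Z (resolvent \<gamma> (localization A xb ub e))))"

definition erosion :: "'a::ab_group_add set \<Rightarrow> 'a set \<Rightarrow> 'a set" where
  "erosion U B = {z. (\<lambda>b. z + b) ` B \<subseteq> U}"

definition identification_set ::
  "('a::real_normed_vector \<Rightarrow> 'a set) \<Rightarrow> 'a set \<Rightarrow> 'a \<Rightarrow> 'a \<Rightarrow> real \<Rightarrow> real \<Rightarrow> 'a set" where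
  "identification_set A M xb ub e \<gamma> =
     (\<Union>x\<in>M \<inter> ball xb e. {x + \<gamma> *\<^sub>R u | u. u \<in> localization A xb ub e x})"

end

theory Submission
  imports Defs
begin

text \<open>
  Since \<open>r Id + A\<^sub>\<epsilon>\<close> is monotone and \<open>\<gamma> r < 1\<close>, the point \<open>x + \<gamma> u\<close> with \<open>u \<in> A\<^sub>\<epsilon> x\<close> determines \<open>x\<close>, which
  gives (ii). For (i), continuity of \<open>A\<close> along \<open>M\<close> and \<open>ub \<in> ri (A xb)\<close> yield a continuous family of
  points \<open>g x \<nu> \<in> A x\<close>, for \<open>x \<in> M\<close> near \<open>xb\<close> and \<open>\<nu>\<close> in an open subset of \<open>N = Lin (A xb)\<close>, that is
  injective in \<open>\<nu>\<close>. In a chart of \<open>M\<close> modelled on a subspace \<open>W\<close>, the map \<open>(x, \<nu>) \<mapsto> x + \<gamma> g x \<nu>\<close> is then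
  continuous and injective on an open subset of \<open>W \<times> N\<close>. As \<open>N\<close> is the normal space of \<open>M\<close> at \<open>xb\<close>,
  \<open>W \<times> N\<close> has at least the dimension of the whole space, and invariance of domain shows that the
  image is open.
\<close>

section \<open>Injectivity coming from monotonicity\<close>

text \<open>Test monotonicity against \<open>d = x - y\<close>. By \<open>eq\<close>,
  \<open>\<gamma> *\<^sub>R (u - v) = - d\<close>, so the inequality scaled by
  \<open>\<gamma>\<close> reads \<open>0 \<le> (\<gamma> * r - 1) * (d \<bullet> d)\<close>, which
  forces \<open>d = 0\<close>.\<close>

lemma monotone_op_resolvent_unique:
  fixes B :: "'a::real_inner \<Rightarrow> 'a set"
  assumes mono: "monotone_op (\<lambda>x. {r *\<^sub>R x + u | u. u \<in> B x})"
    and "0 < \<gamma>" "\<gamma> * r < 1"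
    and "u \<in> B x" "v \<in> B y" and eq: "x + \<gamma> *\<^sub>R u = y + \<gamma> *\<^sub>R v"
  shows "x = y"
proof -
  define d where "d = x - y"
  have "0 \<le> ((r *\<^sub>R x + u) - (r *\<^sub>R y + v)) \<bullet> (x - y)"
    using mono \<open>u \<in> B x\<close> \<open>v \<in> B y\<close> unfolding monotone_op_def by blast
  also have "(r *\<^sub>R x + u) - (r *\<^sub>R y + v) = r *\<^sub>R d + (u - v)"
    by (simp add: d_def algebra_simps)
  finally have "0 \<le> \<gamma> * ((r *\<^sub>R d + (u - v)) \<bullet> d)"
    unfolding d_def[symmetric] using \<open>0 < \<gamma>\<close> by simp
  also have "\<dots> = (\<gamma> * r) * (d \<bullet> d) + (\<gamma> *\<^sub>R (u - v)) \<bullet> d"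
    by (simp add: algebra_simps)
  also have "\<gamma> *\<^sub>R (u - v) = - d"
    using eq by (simp add: d_def algebra_simps)
  finally have "(1 - \<gamma> * r) * (d \<bullet> d) \<le> 0"
    by (simp add: algebra_simps)
  then have "d \<bullet> d \<le> 0"
    using \<open>\<gamma> * r < 1\<close> by (simp add: mult_le_0_iff)
  then have "d = 0"
    by (metis inner_eq_zero_iff inner_ge_zero order_antisym)
  then show ?thesis
    by (simp add: d_def)
qed

lemma monotone_op_localization_mono:
  assumes "monotone_op (\<lambda>x. {r *\<^sub>R x + u | u. u \<in> localization A xb ub e x})" "\<epsilon> \<le> e"
  shows "monotone_op (\<lambda>x. {r *\<^sub>R x + u | u. u \<in> localization A xb ub \<epsilon> x})"
proof -
  have "localization A xb ub \<epsilon> x \<subseteq> localization A xb ub e x" for x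
    using \<open>\<epsilon> \<le> e\<close> by (auto simp: localization_def)
  then have "{r *\<^sub>R x + u | u. u \<in> localization A xb ub \<epsilon> x}
      \<subseteq> {r *\<^sub>R x + u | u. u \<in> localization A xb ub e x}" for x
    by blast
  then show ?thesis
    using assms(1) unfolding monotone_op_def by (meson subsetD)
qed

section \<open>Projections onto continuously varying convex sets\<close>

text \<open>Lower semicontinuity supplies competitors \<open>Y n\<close> that keep the projections
  bounded; upper semicontinuity puts their cluster points into \<open>A a\<close>. In the limit such
  a point is no farther from \<open>v\<close> than the projection onto \<open>A a\<close>, so it
  equals it by uniqueness of nearest points in a closed convex set.\<close>

lemma continuous_on_closest_point_set_valued:
  fixes A :: "'a::metric_space \<Rightarrow> 'b::euclidean_space set"
  assumes ccn: "\<And>x. x \<in> S \<Longrightarrow> A x \<noteq> {} \<and> closed (A x) \<and> convex (A x)"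
    and cont: "\<And>x. x \<in> S \<Longrightarrow> continuous_along S A x"
  shows "continuous_on S (\<lambda>x. closest_point (A x) v)"
  unfolding continuous_on_sequentially comp_def
proof (intro ballI allI impI, elim conjE)
  fix X a
  assume a: "a \<in> S" and XS: "\<forall>n::nat. X n \<in> S" and Xa: "X \<longlonglongrightarrow> a"
  define p where "p x = closest_point (A x) v" for x
  have pA: "p x \<in> A x" if "x \<in> S" for x
    using ccn[OF that] by (simp add: p_def closest_point_in_set)
  have ple: "dist v (p x) \<le> dist v y" if "x \<in> S" "y \<in> A x" for x y
    using ccn[OF that(1)] that(2) by (simp add: p_def closest_point_le)
  have "\<forall>n. X n \<in> S \<inter> dom_op A"
    using XS ccn by (auto simp: dom_op_def)
  then obtain Y where Y: "\<And>n. Y n \<in> A (X n)" and Yp: "Y \<longlonglongrightarrow> p a"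
    using cont[OF a] pA[OF a] Xa unfolding continuous_along_def lsc_along_def by blast
  have "(\<lambda>n. p (X n)) \<longlonglongrightarrow> p a"
  proof (rule ccontr)
    assume "\<not> ?thesis"
    then obtain \<epsilon> where "\<epsilon> > 0" and "\<not> (\<forall>\<^sub>F n in sequentially. dist (p (X n)) (p a) < \<epsilon>)"
      unfolding tendsto_iff by blast
    then obtain s :: "nat \<Rightarrow> nat" where s: "strict_mono s"
      and far: "\<And>n. \<epsilon> \<le> dist (p (X (s n))) (p a)"
      using not_eventually_sequentiallyD by (metis not_less)
    have "bounded (range Y)"
      using Yp by (rule convergent_imp_bounded)
    then obtain C where C: "\<And>n. dist v (Y n) \<le> C"
      unfolding bounded_any_center[where a = v] by auto
    have "bounded (range (\<lambda>n. p (X (s n))))"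
      unfolding bounded_any_center[where a = v]
      using ple[OF _ Y] C XS order_trans by (metis (no_types, lifting) imageE)
    then obtain q t where t: "strict_mono (t :: nat \<Rightarrow> nat)"
      and q: "((\<lambda>n. p (X (s n))) \<circ> t) \<longlonglongrightarrow> q"
      using bounded_imp_convergent_subsequence by metis
    have st: "strict_mono (\<lambda>n. s (t n))"
      using strict_mono_o[OF s t] by (simp add: comp_def)
    have q': "(\<lambda>n. p (X (s (t n)))) \<longlonglongrightarrow> q"
      using q by (simp add: comp_def)
    have Xst: "(\<lambda>n. X (s (t n))) \<longlonglongrightarrow> a" and Yst: "(\<lambda>n. Y (s (t n))) \<longlonglongrightarrow> p a"
      using LIMSEQ_subseq_LIMSEQ[OF Xa st] LIMSEQ_subseq_LIMSEQ[OF Yp st]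
      by (simp_all add: comp_def)
    have "q \<in> A a"
    proof -
      have usc: "u \<in> A a" if "\<forall>n. Z n \<in> S \<and> U n \<in> A (Z n)" "Z \<longlonglongrightarrow> a" "U \<longlonglongrightarrow> u" for Z U u
        using cont[OF a] that unfolding continuous_along_def usc_along_def by blast
      show ?thesis
        by (rule usc[OF _ Xst q']) (use XS pA in blast)
    qed
    have "dist v q \<le> dist v (p a)"
    proof (rule tendsto_le[OF trivial_limit_sequentially])
      show "(\<lambda>n. dist v (Y (s (t n)))) \<longlonglongrightarrow> dist v (p a)"
        "(\<lambda>n. dist v (p (X (s (t n))))) \<longlonglongrightarrow> dist v q"
        using Yst q' by (auto intro!: tendsto_intros)
      show "\<forall>\<^sub>F n in sequentially. dist v (p (X (s (t n)))) \<le> dist v (Y (s (t n)))"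
        using ple XS Y by simp
    qed
    then have "q = p a"
      unfolding p_def using ccn[OF a] \<open>q \<in> A a\<close>
      by (intro closest_point_unique) (auto intro: order_trans[OF _ closest_point_le])
    moreover have "\<epsilon> \<le> dist q (p a)"
      using far by (intro tendsto_lowerbound[OF tendsto_dist[OF q' tendsto_const]]) auto
    ultimately show False
      using \<open>\<epsilon> > 0\<close> by simp
  qed
  then show "(\<lambda>n. closest_point (A (X n)) v) \<longlonglongrightarrow> closest_point (A a) v"
    by (simp add: p_def)
qed

lemma continuous_along_subset:
  assumes "continuous_along M A x" "S \<subseteq> M"
  shows "continuous_along S A x"
  using assms unfolding continuous_along_def lsc_along_def usc_along_def by blast

text \<open>With \<open>v = y - x\<close>, the point \<open>u + v\<close> is an affine combination
  of \<open>u\<close>, \<open>y\<close> and \<open>x\<close> with coefficients 1, 1, -1, so it stays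
  in the affine hull, where a ball around \<open>u\<close> lies in \<open>S\<close>.\<close>

lemma rel_interior_add_Lin:
  assumes "u \<in> rel_interior S"
  obtains \<rho> where "0 < \<rho>" "\<And>v. v \<in> Lin S \<Longrightarrow> norm v < \<rho> \<Longrightarrow> u + v \<in> S"
proof -
  obtain e where "e > 0" and e: "ball u e \<inter> affine hull S \<subseteq> S" and "u \<in> S"
    using assms by (auto simp: mem_rel_interior_ball)
  have "u + v \<in> S" if v: "v \<in> Lin S" "norm v < e" for v
  proof -
    obtain x y where "v = y - x" "x \<in> S" "y \<in> affine hull S"
      using v(1) by (auto simp: Lin_def)
    then have "u + v \<in> affine hull S"
      using mem_affine_3_minus[OF affine_affine_hull, of u S y x 1] \<open>u \<in> S\<close> by (simp add: hull_inc)
    moreover have "u + v \<in> ball u e"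
      using v(2) by (simp add: dist_norm)
    ultimately show ?thesis
      using e by blast
  qed
  with \<open>e > 0\<close> that show ?thesis by blast
qed

section \<open>Charts and the dimension of the normal space\<close>

text \<open>The dimension bound is the point: velocities of curves in \<open>M\<close> through
  \<open>x\<close> lie in the image of \<open>W\<close> under the derivative of the inverse chart,
  and passing to orthogonal complements bounds the normal space from below.\<close>

lemma manifold_chart:
  fixes M :: "'a::euclidean_space set"
  assumes "manifold_around p M x" "x \<in> M" "1 \<le> p"
  obtains V W :: "'a set" and \<psi> :: "'a \<Rightarrow> 'a" and w where "open V" "subspace W" "continuous_on V \<psi>" "inj_on \<psi> V"
    "\<psi> ` (W \<inter> V) \<subseteq> M" "w \<in> W \<inter> V" "\<psi> w = x"
    "DIM('a) \<le> dim W + dim (normal_space M x)"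
proof -
  obtain U V W :: "'a set" and \<phi> \<psi> where "open U" "x \<in> U" "open V" "subspace W"
    and hom: "homeomorphism U V \<phi> \<psi>" and "Ck_on p \<phi> U" "Ck_on p \<psi> V"
    and im: "\<phi> ` (M \<inter> U) = W \<inter> V"
    using assms(1) unfolding manifold_around_def by blast
  \<comment> \<open>One unfolding of \<open>Ck_on\<close> at \<open>Suc k\<close> yields
    differentiability of both chart maps.\<close>
  obtain k where "p = Suc k"
    using \<open>1 \<le> p\<close> by (cases p) auto
  have "\<phi> x \<in> W \<inter> V"
    using im \<open>x \<in> M\<close> \<open>x \<in> U\<close> by blast
  have \<psi>\<phi>: "\<psi> (\<phi> y) = y" if "y \<in> U" for y
    using hom that by (simp add: homeomorphism_apply1)
  obtain \<phi>' where \<phi>': "(\<phi> has_derivative \<phi>') (at x)"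
    using \<open>Ck_on p \<phi> U\<close> \<open>x \<in> U\<close> \<open>p = Suc k\<close> by (auto simp: differentiable_def)
  obtain \<psi>' where \<psi>': "(\<psi> has_derivative \<psi>') (at (\<phi> x))"
    using \<open>Ck_on p \<psi> V\<close> \<open>\<phi> x \<in> W \<inter> V\<close> \<open>p = Suc k\<close> by (auto simp: differentiable_def)
  obtain B where B: "B \<subseteq> W" "pairwise orthogonal B" "\<And>x. x \<in> B \<Longrightarrow> norm x = 1"
      "independent B" "span B = W"
    using orthonormal_basis_subspace[OF \<open>subspace W\<close>] by metis
  have "finite B"
    using \<open>independent B\<close> by (rule independent_imp_finite)
  \<comment> \<open>\<open>P\<close> is the orthogonal projection onto \<open>W\<close>. Inserted
    between \<open>\<phi>\<close> and \<open>\<psi>\<close>, it leaves curves in \<open>M\<close>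
    unchanged, yet makes the chain rule produce a value of \<open>\<psi>'\<close> at a point of
    \<open>W\<close>.\<close>
  define P where "P y = (\<Sum>b\<in>B. (y \<bullet> b) *\<^sub>R b)" for y
  have PW: "P y \<in> W" for y
    unfolding P_def using B(1) \<open>subspace W\<close> by (intro subspace_sum subspace_scale) auto
  have Pid: "P y = y" if "y \<in> W" for y
    unfolding P_def using orthonormal_basis_expand[OF B(2,3) _ \<open>finite B\<close>] that B(5) by simp
  have P: "(P has_derivative P) (at y)" for y
    unfolding P_def by (auto intro!: derivative_eq_intros)
  have tan: "tangent_space M x \<subseteq> \<psi>' ` W"
  proof
    fix v assume "v \<in> tangent_space M x"
    then obtain c e where "0 < e" "c ` {-e<..<e} \<subseteq> M" "c 0 = x"
      and c: "(c has_vector_derivative v) (at 0)"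
      unfolding tangent_space_def by blast
    have c': "(c has_derivative (\<lambda>h. h *\<^sub>R v)) (at 0)"
      using c by (simp add: has_vector_derivative_def)
    have "(c \<longlongrightarrow> x) (at 0)"
      using has_vector_derivative_continuous[OF c] \<open>c 0 = x\<close> by (simp add: continuous_at)
    then have "\<forall>\<^sub>F t in at 0. c t \<in> U"
      using \<open>open U\<close> \<open>x \<in> U\<close> by (rule topological_tendstoD)
    moreover have "\<forall>\<^sub>F t in at 0. t \<in> {-e<..<e}"
      using \<open>0 < e\<close> by (intro eventually_at_in_open') auto
    ultimately have ev: "\<forall>\<^sub>F t in at 0. \<psi> (P (\<phi> (c t))) = c t"
    proof eventually_elim
      case (elim t)
      then have "\<phi> (c t) \<in> W"
        using im \<open>c ` {-e<..<e} \<subseteq> M\<close> by blast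
      with elim show ?case
        by (simp add: Pid \<psi>\<phi>)
    qed
    \<comment> \<open>The same curve is differentiated twice: by the chain rule, and as
      \<open>c\<close> itself, with which it agrees near 0.\<close>
    have "((\<psi> \<circ> (P \<circ> (\<phi> \<circ> c))) has_derivative (\<psi>' \<circ> (P \<circ> (\<phi>' \<circ> (\<lambda>h. h *\<^sub>R v))))) (at 0)"
      using \<phi>' \<psi>' P \<open>\<phi> x \<in> W \<inter> V\<close>
      by (intro diff_chain_at c') (simp_all add: \<open>c 0 = x\<close> Pid)
    moreover have "((\<psi> \<circ> (P \<circ> (\<phi> \<circ> c))) has_derivative (\<lambda>h. h *\<^sub>R v)) (at 0)"
      using c' by (rule has_derivative_transform_eventually)
        (use ev \<open>x \<in> U\<close> \<open>\<phi> x \<in> W \<inter> V\<close> in \<open>auto simp: \<open>c 0 = x\<close> Pid \<psi>\<phi> elim: eventually_mono\<close>)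
    ultimately have "\<psi>' \<circ> (P \<circ> (\<phi>' \<circ> (\<lambda>h. h *\<^sub>R v))) = (\<lambda>h. h *\<^sub>R v)"
      by (rule has_derivative_unique)
    then have "\<psi>' (P (\<phi>' (1 *\<^sub>R v))) = 1 *\<^sub>R v"
      unfolding fun_eq_iff comp_def by (rule spec)
    then show "v \<in> \<psi>' ` W"
      using PW by (metis image_eqI scaleR_one)
  qed
  have "linear \<psi>'"
    using \<psi>' by (rule has_derivative_linear)
  then have "dim (\<psi>' ` W) \<le> dim W"
    by (rule dim_image_le)
  moreover have "subspace (\<psi>' ` W)"
    using \<open>linear \<psi>'\<close> \<open>subspace W\<close> by (rule linear_subspace_image)
  then have "dim ((\<psi>' ` W)\<^sup>\<bottom>) + dim (\<psi>' ` W) = DIM('a)"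
    using dim_subspace_orthogonal_to_vectors[of "\<psi>' ` W" UNIV]
    by (simp add: orthogonal_comp_def)
  moreover have "dim ((\<psi>' ` W)\<^sup>\<bottom>) \<le> dim (normal_space M x)"
    unfolding normal_space_def by (intro dim_subset orthogonal_comp_anti_mono tan)
  ultimately have dim: "DIM('a) \<le> dim W + dim (normal_space M x)"
    by linarith
  have "continuous_on V \<psi>"
    using hom by (rule homeomorphism_cont2)
  moreover have "inj_on \<psi> V"
    using hom by (metis homeomorphism_apply2 inj_on_inverseI)
  moreover have "\<psi> ` (W \<inter> V) \<subseteq> M"
    unfolding im[symmetric] using \<psi>\<phi> by auto
  ultimately show ?thesis
    using \<open>open V\<close> \<open>subspace W\<close> \<open>\<phi> x \<in> W \<inter> V\<close> \<psi>\<phi>[OF \<open>x \<in> U\<close>] dim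
    by (intro that[of V W \<psi> "\<phi> x"])
qed

section \<open>Continuous injective selections\<close>

text \<open>
  For \<open>x\<close> near \<open>a\<close> the vectors \<open>p b x \<in> A x\<close> below, with \<open>b = 0\<close> or \<open>b\<close> in an orthonormal basis \<open>B\<close>
  of \<open>N\<close>, are near the vertices of a simplex in \<open>A a\<close> with barycentre \<open>u\<close>. The selection is
  \<open>g x \<nu> = p 0 x + (\<Sum>b\<in>B. (\<nu> \<bullet> b) *\<^sub>R (p b x - p 0 x))\<close>: the numbers \<open>\<nu> \<bullet> b\<close> serve as barycentric
  coordinates.
\<close>

lemma continuous_along_selection:
  fixes A :: "'a::euclidean_space \<Rightarrow> 'a set"
  assumes "a \<in> S"
    and ccn: "\<And>x. x \<in> S \<Longrightarrow> A x \<noteq> {} \<and> closed (A x) \<and> convex (A x)"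
    and cont: "\<And>x. x \<in> S \<Longrightarrow> continuous_along S A x"
    and "subspace N" "0 < \<rho>" and ri: "\<And>v. v \<in> N \<Longrightarrow> norm v < \<rho> \<Longrightarrow> u + v \<in> A a"
  obtains Q \<nu>\<^sub>0 \<eta> g where "open Q" "\<nu>\<^sub>0 \<in> Q \<inter> N" "0 < \<eta>"
    "continuous_on (S \<times> N) (\<lambda>(x, \<nu>). g x \<nu>)" "g a \<nu>\<^sub>0 = u"
    "\<And>x \<nu>. x \<in> S \<Longrightarrow> \<nu> \<in> Q \<inter> N \<Longrightarrow> g x \<nu> \<in> A x"
    "\<And>x. x \<in> S \<inter> ball a \<eta> \<Longrightarrow> inj_on (g x) N"
proof -
  obtain B where B: "B \<subseteq> N" "pairwise orthogonal B" "\<And>x. x \<in> B \<Longrightarrow> norm x = 1"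
      "independent B" "span B = N"
    using orthonormal_basis_subspace[OF \<open>subspace N\<close>] by metis
  have "finite B"
    using \<open>independent B\<close> by (rule independent_imp_finite)
  have "0 \<notin> B"
    using B(3) by force
  have inner_B: "b \<bullet> b' = (if b = b' then 1 else 0)" if "b \<in> B" "b' \<in> B" for b b'
    using B(2,3) that by (auto simp: pairwise_def orthogonal_def dot_square_norm)
  \<comment> \<open>The number of vertices of the simplex: one for each element of \<open>B\<close>
    and one for 0.\<close>
  define m where "m = real (card B) + 1"
  have "m > 0"
    by (simp add: m_def)
  \<comment> \<open>As \<open>norm s \<le> 1\<close>, the vertices are at distance at most
    \<open>2 * c < \<rho>\<close> from \<open>u\<close>, within reach of \<open>ri\<close>.\<close>
  define c where "c = \<rho> / 3"
  have "c > 0"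
    using \<open>0 < \<rho>\<close> by (simp add: c_def)
  \<comment> \<open>The barycentre of 0 and \<open>B\<close>; all its barycentric coordinates are
    \<open>1 / m\<close>, and it becomes \<open>\<nu>\<^sub>0\<close>.\<close>
  define s where "s = (\<Sum>b\<in>B. (1 / m) *\<^sub>R b)"
  have "s \<in> N"
    unfolding s_def using B(1) \<open>subspace N\<close> by (intro subspace_sum subspace_scale) auto
  have "norm s \<le> (\<Sum>b\<in>B. norm ((1 / m) *\<^sub>R b))"
    unfolding s_def by (rule norm_sum)
  also have "\<dots> = card B / m"
    using B(3) \<open>m > 0\<close> by simp
  also have "\<dots> \<le> 1"
    using \<open>m > 0\<close> by (simp add: m_def)
  finally have "norm s \<le> 1" .
  define p where "p b x = closest_point (A x) (u - c *\<^sub>R s + c *\<^sub>R b)" for b x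
  have contp: "continuous_on S (p b)" for b
    unfolding p_def using ccn cont by (rule continuous_on_closest_point_set_valued)
  have pA: "p b x \<in> A x" if "x \<in> S" for b x
    using ccn[OF that] by (simp add: p_def closest_point_in_set)
  have pa: "p b a = u - c *\<^sub>R s + c *\<^sub>R b" if "b \<in> insert 0 B" for b
  proof -
    have "norm (c *\<^sub>R b - c *\<^sub>R s) \<le> norm (c *\<^sub>R b) + norm (c *\<^sub>R s)"
      by (rule norm_triangle_ineq4)
    also have "\<dots> \<le> c + c"
      using \<open>c > 0\<close> \<open>norm s \<le> 1\<close> B(3) that by (intro add_mono) auto
    also have "\<dots> < \<rho>"
      using \<open>0 < \<rho>\<close> by (simp add: c_def)
    finally have "u + (c *\<^sub>R b - c *\<^sub>R s) \<in> A a"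
      using that B(1) \<open>subspace N\<close> \<open>s \<in> N\<close>
      by (intro ri subspace_diff subspace_scale) (auto simp: subspace_0)
    then show ?thesis
      by (simp add: p_def closest_point_self algebra_simps)
  qed
  define d where "d b x = p b x - p 0 x" for b x
  define g where "g x \<nu> = p 0 x + (\<Sum>b\<in>B. (\<nu> \<bullet> b) *\<^sub>R d b x)" for x \<nu>
  \<comment> \<open>The coordinates of all vertices are positive; that of 0 is one minus the
    sum.\<close>
  define Q where "Q = {\<nu>. \<forall>b\<in>B. 0 < \<nu> \<bullet> b} \<inter> {\<nu>. (\<Sum>b\<in>B. \<nu> \<bullet> b) < 1}"
  have da: "d b a = c *\<^sub>R b" if "b \<in> B" for b
    using that by (simp add: d_def pa)
  have s_inner: "s \<bullet> b = 1 / m" if "b \<in> B" for b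
    unfolding s_def inner_sum_left
    using that \<open>finite B\<close> by (simp add: inner_B if_distrib cong: if_cong)
  \<comment> \<open>The tolerance \<open>c / m\<close>, summed over the \<open>m - 1\<close>
    elements of \<open>B\<close>, stays below \<open>c\<close>; this is what makes
    \<open>g x\<close> injective.\<close>
  have "\<forall>\<^sub>F x in at a within S. \<forall>b\<in>B. dist (d b x) (c *\<^sub>R b) < c / m"
  proof (rule eventually_ball_finite[OF \<open>finite B\<close>], rule ballI)
    fix b assume "b \<in> B"
    have "continuous_on S (d b)"
      unfolding d_def by (intro continuous_intros contp)
    then have "(d b \<longlongrightarrow> c *\<^sub>R b) (at a within S)"
      using \<open>a \<in> S\<close> da[OF \<open>b \<in> B\<close>] by (auto simp: continuous_on_def)
    then show "\<forall>\<^sub>F x in at a within S. dist (d b x) (c *\<^sub>R b) < c / m"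
      using \<open>c > 0\<close> \<open>m > 0\<close> by (intro tendstoD) auto
  qed
  then obtain \<eta> where "\<eta> > 0"
    and \<eta>': "\<And>x b. x \<in> S \<Longrightarrow> x \<noteq> a \<Longrightarrow> dist x a < \<eta> \<Longrightarrow> b \<in> B \<Longrightarrow> dist (d b x) (c *\<^sub>R b) < c / m"
    unfolding eventually_at by blast
  \<comment> \<open>The filter \<open>at a within S\<close> leaves out \<open>a\<close> itself,
    where the difference vanishes by \<open>da\<close>.\<close>
  have \<eta>: "norm (d b x - c *\<^sub>R b) \<le> c / m" if "x \<in> S \<inter> ball a \<eta>" "b \<in> B" for x b
  proof (cases "x = a")
    case True
    then show ?thesis
      using that \<open>c > 0\<close> \<open>m > 0\<close> by (simp add: da)
  next
    case False
    then show ?thesis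
      using \<eta>'[of x b] that by (simp add: dist_norm norm_minus_commute dist_commute)
  qed
  show ?thesis
  proof (rule that[of Q s \<eta> g])
    have "Q = (\<Inter>b\<in>B. {\<nu>. 0 < \<nu> \<bullet> b}) \<inter> {\<nu>. (\<Sum>b\<in>B. \<nu> \<bullet> b) < 1}"
      by (auto simp: Q_def)
    then show "open Q"
      using \<open>finite B\<close>
      by (auto intro!: open_Int open_INT open_Collect_less continuous_intros)
    show "s \<in> Q \<inter> N"
      using \<open>s \<in> N\<close> \<open>m > 0\<close> by (auto simp: Q_def s_inner m_def)
    show "\<eta> > 0" by fact
    have "(\<Sum>b\<in>B. (s \<bullet> b) *\<^sub>R d b a) = c *\<^sub>R s"
      unfolding s_def scaleR_sum_right
      by (intro sum.cong) (simp_all add: da s_inner flip: s_def)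
    then show "g a s = u"
      using pa[of 0] by (simp add: g_def)
    have "continuous_on (S \<times> N) (\<lambda>y. p b (fst y))" for b
      using contp by (intro continuous_on_compose2[OF contp] continuous_intros) auto
    then show "continuous_on (S \<times> N) (\<lambda>(x, \<nu>). g x \<nu>)"
      unfolding g_def d_def case_prod_beta by (intro continuous_intros)
    show "g x \<nu> \<in> A x" if "x \<in> S" "\<nu> \<in> Q \<inter> N" for x \<nu>
    proof -
      define w where "w b = (if b = 0 then 1 - (\<Sum>b\<in>B. \<nu> \<bullet> b) else \<nu> \<bullet> b)" for b
      have wB: "w b = \<nu> \<bullet> b" if "b \<in> B" for b
        using that \<open>0 \<notin> B\<close> by (auto simp: w_def)
      have "(\<Sum>b\<in>insert 0 B. w b *\<^sub>R p b x) \<in> A x"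
      proof (rule convex_sum)
        show "sum w (insert 0 B) = 1"
          using \<open>finite B\<close> \<open>0 \<notin> B\<close> by (simp add: wB) (simp add: w_def)
        show "0 \<le> w b" if "b \<in> insert 0 B" for b
          using that \<open>\<nu> \<in> Q \<inter> N\<close> by (auto simp: w_def Q_def intro: less_imp_le)
      qed (use \<open>finite B\<close> ccn[OF \<open>x \<in> S\<close>] pA[OF \<open>x \<in> S\<close>] in auto)
      also have "(\<Sum>b\<in>insert 0 B. w b *\<^sub>R p b x) = g x \<nu>"
        using \<open>finite B\<close> \<open>0 \<notin> B\<close>
        by (simp add: wB g_def d_def algebra_simps sum_subtractf scaleR_sum_left)
          (simp add: w_def algebra_simps scaleR_sum_left)
      finally show ?thesis .
    qed
    show "inj_on (g x) N" if x: "x \<in> S \<inter> ball a \<eta>" for x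
    proof (rule inj_onI)
      fix \<nu> \<nu>' assume "\<nu> \<in> N" "\<nu>' \<in> N" and eq: "g x \<nu> = g x \<nu>'"
      define \<mu> where "\<mu> = \<nu> - \<nu>'"
      have "\<mu> \<in> N"
        unfolding \<mu>_def using \<open>subspace N\<close> \<open>\<nu> \<in> N\<close> \<open>\<nu>' \<in> N\<close> by (rule subspace_diff)
      then have "(\<Sum>b\<in>B. (\<mu> \<bullet> b) *\<^sub>R b) = \<mu>"
        using orthonormal_basis_expand[OF B(2,3) _ \<open>finite B\<close>] B(5) by simp
      then have "c *\<^sub>R \<mu> = c *\<^sub>R (\<Sum>b\<in>B. (\<mu> \<bullet> b) *\<^sub>R b)"
        by simp
      also have "\<dots> = (\<Sum>b\<in>B. (\<mu> \<bullet> b) *\<^sub>R c *\<^sub>R b)"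
        by (simp add: scaleR_sum_right mult.commute)
      finally have "c *\<^sub>R \<mu> = (\<Sum>b\<in>B. (\<mu> \<bullet> b) *\<^sub>R c *\<^sub>R b)" .
      moreover have "(\<Sum>b\<in>B. (\<mu> \<bullet> b) *\<^sub>R d b x) = 0"
        using eq by (simp add: g_def \<mu>_def inner_diff_left scaleR_left_diff_distrib sum_subtractf)
      \<comment> \<open>If \<open>g x\<close> identifies two points, their difference
        \<open>\<mu>\<close> is controlled by the deviations of \<open>d b x\<close> from
        \<open>c *\<^sub>R b\<close> alone, giving \<open>c * norm \<mu>\<close> at most
        \<open>(m - 1) / m\<close> times itself.\<close>
      ultimately have "c *\<^sub>R \<mu> = - (\<Sum>b\<in>B. (\<mu> \<bullet> b) *\<^sub>R (d b x - c *\<^sub>R b))"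
        by (simp add: scaleR_right_diff_distrib sum_subtractf)
      then have "norm (c *\<^sub>R \<mu>) \<le> (\<Sum>b\<in>B. norm ((\<mu> \<bullet> b) *\<^sub>R (d b x - c *\<^sub>R b)))"
        by (simp only: norm_minus_cancel norm_sum)
      also have "\<dots> \<le> (\<Sum>b\<in>B. norm \<mu> * (c / m))"
      proof (rule sum_mono)
        fix b assume "b \<in> B"
        have "\<bar>\<mu> \<bullet> b\<bar> \<le> norm \<mu>"
          using Cauchy_Schwarz_ineq2[of \<mu> b] B(3)[OF \<open>b \<in> B\<close>] by simp
        then show "norm ((\<mu> \<bullet> b) *\<^sub>R (d b x - c *\<^sub>R b)) \<le> norm \<mu> * (c / m)"
          unfolding norm_scaleR using \<eta>[OF x \<open>b \<in> B\<close>] by (intro mult_mono) auto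
      qed
      finally have "c * norm \<mu> \<le> (m - 1) * (norm \<mu> * (c / m))"
        using \<open>c > 0\<close> by (simp add: m_def)
      then have "c * norm \<mu> * (1 / m) \<le> 0"
        using \<open>m > 0\<close> by (simp add: field_simps)
      then have "norm \<mu> \<le> 0"
        using \<open>c > 0\<close> \<open>m > 0\<close> by (simp add: mult_le_0_iff divide_le_0_iff)
      then show "\<nu> = \<nu>'"
        by (simp add: \<mu>_def)
    qed
  qed
qed

section \<open>Openness by invariance of domain, and identification\<close>

theorem theorem4:
  fixes A :: "real ^ 'n \<Rightarrow> (real ^ 'n) set"
    and M :: "(real ^ 'n) set"
    and xb ub :: "real ^ 'n"
    and p :: nat and r \<gamma> :: real
  assumes "1 \<le> p" and "manifold p M" and "xb \<in> M"
    and A1: "partly_smooth p M A xb"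
    and A2: "resolvent_regular r A xb ub"
    and A3: "ub \<in> rel_interior (A xb)"
    and "\<gamma> \<in> {0<..<1/r}"
  shows "\<exists>\<epsilon>\<^sub>0>0. \<forall>\<epsilon>. 0 < \<epsilon> \<and> \<epsilon> < \<epsilon>\<^sub>0 \<longrightarrow>
    xb + \<gamma> *\<^sub>R ub \<in> interior (identification_set A M xb ub \<epsilon> \<gamma>) \<and>
    (\<exists>\<delta>\<^sub>0>0. \<forall>\<delta>. 0 < \<delta> \<and> \<delta> < \<delta>\<^sub>0 \<longrightarrow>
      (\<forall>x u :: nat \<Rightarrow> real ^ 'n. (\<forall>k. u k \<in> localization A xb ub \<epsilon> (x k)) \<longrightarrow>
        (\<forall>k. x k + \<gamma> *\<^sub>R u k \<in> erosion (identification_set A M xb ub \<epsilon> \<gamma>) (ball 0 \<delta>)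
           \<longrightarrow> x k \<in> M)))"
proof -
  have "0 < r" "ub \<in> A xb"
    using A2 by (auto simp: resolvent_regular_def)
  then have "0 < \<gamma>" "\<gamma> * r < 1"
    using \<open>\<gamma> \<in> {0<..<1/r}\<close> by (auto simp: field_simps)
  obtain e where "0 < e"
    and mono: "monotone_op (\<lambda>x. {r *\<^sub>R x + u | u. u \<in> localization A xb ub e x})"
    using A2 unfolding resolvent_regular_def by blast
  \<comment> \<open>This serves both conclusions: injectivity of the parametrization
    \<open>F\<close> in (i) and recovery of the base point in (ii).\<close>
  have unique: "x = y"
    if "\<epsilon> \<le> e" "u \<in> localization A xb ub \<epsilon> x" "v \<in> localization A xb ub \<epsilon> y"
      "x + \<gamma> *\<^sub>R u = y + \<gamma> *\<^sub>R v" for \<epsilon> x y u v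
    using monotone_op_resolvent_unique[OF monotone_op_localization_mono[OF mono that(1)]
        \<open>0 < \<gamma>\<close> \<open>\<gamma> * r < 1\<close> that(2,3,4)] .
  obtain e1 where "0 < e1" and e1: "\<And>y. dist y xb < e1 \<Longrightarrow> A y \<noteq> {} \<and> closed (A y) \<and> convex (A y)"
    using A1 unfolding partly_smooth_def eventually_nhds_metric by blast
  obtain e2 where "0 < e2" and e2: "\<And>y. y \<in> M \<inter> ball xb e2 \<Longrightarrow> continuous_along M A y"
    using A1 unfolding partly_smooth_def by blast
  define N where "N = normal_space M xb"
  have "subspace N"
    unfolding N_def normal_space_def by (rule subspace_orthogonal_comp)
  have "N = Lin (A xb)"
    using A1 by (simp add: N_def partly_smooth_def)
  then obtain \<rho> where "0 < \<rho>" and \<rho>: "\<And>v. v \<in> N \<Longrightarrow> norm v < \<rho> \<Longrightarrow> ub + v \<in> A xb"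
    using rel_interior_add_Lin[OF A3] by metis
  \<comment> \<open>On this piece of \<open>M\<close> the values are nonempty, closed and convex,
    and \<open>A\<close> is continuous along it.\<close>
  define S where "S = M \<inter> ball xb (min e1 e2)"
  have "xb \<in> S"
    using \<open>xb \<in> M\<close> \<open>0 < e1\<close> \<open>0 < e2\<close> by (simp add: S_def)
  have ccn: "A x \<noteq> {} \<and> closed (A x) \<and> convex (A x)" if "x \<in> S" for x
    using that by (intro e1) (simp add: S_def dist_commute)
  have cont: "continuous_along S A x" if "x \<in> S" for x
    using that by (intro continuous_along_subset[OF e2]) (auto simp: S_def)
  obtain Q \<nu>\<^sub>0 \<eta> g where "open Q" "\<nu>\<^sub>0 \<in> Q \<inter> N" "0 < \<eta>"
    and contg: "continuous_on (S \<times> N) (\<lambda>(x, \<nu>). g x \<nu>)"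
    and "g xb \<nu>\<^sub>0 = ub"
    and gA: "\<And>x \<nu>. x \<in> S \<Longrightarrow> \<nu> \<in> Q \<inter> N \<Longrightarrow> g x \<nu> \<in> A x"
    and injg: "\<And>x. x \<in> S \<inter> ball xb \<eta> \<Longrightarrow> inj_on (g x) N"
    using \<open>xb \<in> S\<close> ccn cont \<open>subspace N\<close> \<open>0 < \<rho>\<close> \<rho> by (rule continuous_along_selection) (assumption | rule that)+
  have "manifold_around p M xb"
    using \<open>manifold p M\<close> \<open>xb \<in> M\<close> by (simp add: manifold_def)
  then obtain V W :: "(real ^ 'n) set" and \<psi> w\<^sub>0 where "open V" "subspace W" and cont\<psi>: "continuous_on V \<psi>"
    and inj\<psi>: "inj_on \<psi> V" and \<psi>M: "\<psi> ` (W \<inter> V) \<subseteq> M" and "w\<^sub>0 \<in> W \<inter> V" "\<psi> w\<^sub>0 = xb"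
    and dim: "DIM(real ^ 'n) \<le> dim W + dim N"
    using \<open>xb \<in> M\<close> \<open>1 \<le> p\<close> by (rule manifold_chart) (rule that[unfolded N_def])
  \<comment> \<open>\<open>e\<close> is for \<open>unique\<close>, \<open>e1\<close> and
    \<open>e2\<close> for the selection on \<open>S\<close>, \<open>\<eta>\<close> for injectivity
    of \<open>g x\<close>.\<close>
  define \<epsilon>\<^sub>0 where "\<epsilon>\<^sub>0 = Min {e, e1, e2, \<eta>}"
  have "0 < \<epsilon>\<^sub>0"
    using \<open>0 < e\<close> \<open>0 < e1\<close> \<open>0 < e2\<close> \<open>0 < \<eta>\<close> by (simp add: \<epsilon>\<^sub>0_def)
  have int: "xb + \<gamma> *\<^sub>R ub \<in> interior (identification_set A M xb ub \<epsilon> \<gamma>)"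
    if "0 < \<epsilon>" "\<epsilon> < \<epsilon>\<^sub>0" for \<epsilon>
  proof -
    have "\<epsilon> \<le> e" "\<epsilon> \<le> min e1 e2" "\<epsilon> \<le> \<eta>"
      using \<open>\<epsilon> < \<epsilon>\<^sub>0\<close> by (auto simp: \<epsilon>\<^sub>0_def)
    define G where "G y = g (\<psi> (fst y)) (snd y)" for y
    define F where "F y = \<psi> (fst y) + \<gamma> *\<^sub>R G y" for y
    define V' where "V' = V \<inter> \<psi> -` ball xb \<epsilon>"
    have "open V'"
      unfolding V'_def using cont\<psi> \<open>open V\<close> by (intro continuous_open_preimage) auto
    have V'S: "\<psi> w \<in> S \<inter> ball xb \<eta> \<and> \<psi> w \<in> ball xb \<epsilon>" if "w \<in> W \<inter> V'" for w
      using that \<psi>M \<open>\<epsilon> \<le> min e1 e2\<close> \<open>\<epsilon> \<le> \<eta>\<close> by (auto simp: S_def V'_def)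
    define D\<^sub>1 where "D\<^sub>1 = (W \<times> N) \<inter> (V' \<times> Q)"
    have "openin (top_of_set (W \<times> N)) D\<^sub>1"
      unfolding D\<^sub>1_def using \<open>open V'\<close> \<open>open Q\<close> by (intro openin_open_Int open_Times)
    have cont\<psi>1: "continuous_on D\<^sub>1 (\<lambda>y. \<psi> (fst y))"
      by (rule continuous_on_compose2[OF cont\<psi>]) (auto simp: D\<^sub>1_def V'_def intro!: continuous_intros)
    have contG: "continuous_on D\<^sub>1 G"
    proof -
      have "continuous_on D\<^sub>1 (\<lambda>y. (\<psi> (fst y), snd y))"
        using cont\<psi>1 by (intro continuous_intros)
      moreover have "(\<lambda>y. (\<psi> (fst y), snd y)) ` D\<^sub>1 \<subseteq> S \<times> N"
        using V'S by (auto simp: D\<^sub>1_def)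
      ultimately show ?thesis
        using continuous_on_compose2[OF contg, of D\<^sub>1 "\<lambda>y. (\<psi> (fst y), snd y)"] by (simp add: G_def)
    qed
    \<comment> \<open>\<open>D\<^sub>1\<close> keeps the base point within \<open>\<epsilon>\<close>
      of \<open>xb\<close>; the further cut keeps the selected value within
      \<open>\<epsilon>\<close> of \<open>ub\<close>, so that it lies in the localization.\<close>
    define D where "D = D\<^sub>1 \<inter> G -` ball ub \<epsilon>"
    have "openin (top_of_set D\<^sub>1) D"
      unfolding D_def using contG by (intro continuous_openin_preimage_gen) auto
    then have "openin (top_of_set (W \<times> N)) D"
      using \<open>openin (top_of_set (W \<times> N)) D\<^sub>1\<close> by (rule openin_trans)
    have loc: "G y \<in> localization A xb ub \<epsilon> (\<psi> (fst y))" if "y \<in> D" for y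
      using that V'S gA
      by (auto simp: D_def D\<^sub>1_def G_def localization_def dist_norm norm_minus_commute)
    have "open (F ` D)"
    proof -
      have "openin (top_of_set UNIV) (F ` D)"
      proof (rule invariance_of_domain_subspaces)
        show "openin (top_of_set (W \<times> N)) D" by fact
        show "subspace (W \<times> N)"
          using \<open>subspace W\<close> \<open>subspace N\<close> by (rule subspace_Times)
        show "dim (UNIV :: (real ^ 'n) set) \<le> dim (W \<times> N)"
          using dim \<open>subspace W\<close> \<open>subspace N\<close> by (simp add: dim_Times)
        show "continuous_on D F"
          unfolding F_def using cont\<psi>1 contG
          by (intro continuous_intros) (auto simp: D_def intro: continuous_on_subset)
        \<comment> \<open>Monotonicity recovers the base point, hence the chart coordinate;
          cancelling it and \<open>\<gamma>\<close> leaves equal values of \<open>g\<close> at one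
          base point, and \<open>injg\<close> recovers the normal coordinate.\<close>
        show "inj_on F D"
        proof (rule inj_onI)
          fix y z assume "y \<in> D" "z \<in> D" "F y = F z"
          then have eq: "\<psi> (fst y) = \<psi> (fst z)"
            using unique[OF \<open>\<epsilon> \<le> e\<close> loc loc] by (simp add: F_def)
          then have "fst y = fst z"
            using inj\<psi> \<open>y \<in> D\<close> \<open>z \<in> D\<close>
            by (auto simp: D_def D\<^sub>1_def V'_def dest: inj_onD)
          moreover have "g (\<psi> (fst y)) (snd y) = g (\<psi> (fst y)) (snd z)"
            using \<open>F y = F z\<close> eq \<open>0 < \<gamma>\<close> by (simp add: F_def G_def)
          then have "snd y = snd z"
            using injg[of "\<psi> (fst y)"] V'S[of "fst y"] \<open>y \<in> D\<close> \<open>z \<in> D\<close>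
            by (auto simp: D_def D\<^sub>1_def dest: inj_onD)
          ultimately show "y = z"
            by (rule prod_eqI)
        qed
      qed auto
      then show ?thesis
        by simp
    qed
    moreover have "F ` D \<subseteq> identification_set A M xb ub \<epsilon> \<gamma>"
    proof
      fix z assume "z \<in> F ` D"
      then obtain y where "y \<in> D" "z = F y"
        by blast
      moreover from \<open>y \<in> D\<close> have "\<psi> (fst y) \<in> M \<inter> ball xb \<epsilon>"
        using V'S[of "fst y"] by (auto simp: D_def D\<^sub>1_def S_def)
      ultimately show "z \<in> identification_set A M xb ub \<epsilon> \<gamma>"
        unfolding identification_set_def F_def using loc by blast
    qed
    moreover have "xb + \<gamma> *\<^sub>R ub \<in> F ` D"
    proof
      show "xb + \<gamma> *\<^sub>R ub = F (w\<^sub>0, \<nu>\<^sub>0)"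
        by (simp add: F_def G_def \<open>\<psi> w\<^sub>0 = xb\<close> \<open>g xb \<nu>\<^sub>0 = ub\<close>)
      show "(w\<^sub>0, \<nu>\<^sub>0) \<in> D"
        using \<open>w\<^sub>0 \<in> W \<inter> V\<close> \<open>\<nu>\<^sub>0 \<in> Q \<inter> N\<close> \<open>0 < \<epsilon>\<close>
        by (simp add: D_def D\<^sub>1_def V'_def G_def \<open>\<psi> w\<^sub>0 = xb\<close> \<open>g xb \<nu>\<^sub>0 = ub\<close>)
    qed
    ultimately show ?thesis
      by (meson interiorI)
  qed
  have ident: "x \<in> M"
    if "\<epsilon> < \<epsilon>\<^sub>0" "0 < \<delta>" "u \<in> localization A xb ub \<epsilon> x"
      "x + \<gamma> *\<^sub>R u \<in> erosion (identification_set A M xb ub \<epsilon> \<gamma>) (ball 0 \<delta>)" for \<epsilon> \<delta> x u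
  proof -
    \<comment> \<open>The zero vector lies in the ball, so the erosion is contained in the
      identification set.\<close>
    have "x + \<gamma> *\<^sub>R u + 0 \<in> identification_set A M xb ub \<epsilon> \<gamma>"
      using that(2,4) by (force simp: erosion_def)
    then obtain x' u' where "x' \<in> M" "u' \<in> localization A xb ub \<epsilon> x'"
      "x + \<gamma> *\<^sub>R u = x' + \<gamma> *\<^sub>R u'"
      by (auto simp: identification_set_def)
    then show ?thesis
      using unique[of \<epsilon> u x u' x'] that(1,3) by (simp add: \<epsilon>\<^sub>0_def)
  qed
  show ?thesis
  \<comment> \<open>\<open>\<epsilon>\<^sub>0\<close> is the witness for both thresholds, since
    \<open>ident\<close> holds for every positive \<open>\<delta>\<close>.\<close>
  proof (intro exI[of _ \<epsilon>\<^sub>0] conjI allI impI \<open>0 < \<epsilon>\<^sub>0\<close>; (elim conjE)?)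
    fix \<epsilon> assume \<epsilon>: "0 < \<epsilon>" "\<epsilon> < \<epsilon>\<^sub>0"
    then show "xb + \<gamma> *\<^sub>R ub \<in> interior (identification_set A M xb ub \<epsilon> \<gamma>)"
      by (rule int)
    fix \<delta> :: real and x u :: "nat \<Rightarrow> real ^ 'n" and k
    assume "0 < \<delta>" "\<forall>k. u k \<in> localization A xb ub \<epsilon> (x k)"
      "x k + \<gamma> *\<^sub>R u k \<in> erosion (identification_set A M xb ub \<epsilon> \<gamma>) (ball 0 \<delta>)"
    then show "x k \<in> M"
      using ident \<epsilon>(2) by blast
  qed
qed

end
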